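(* Fix $d \ge 1$ and let $S = \mathbb{R}_+^d$. Let $X, \overline{X} : [0,\infty) \to \mathbb{R}^d$ be two continuous functions with $X(0), \overline{X}(0) \in S$ such that $$X(0) \le \overline{X}(0), \qquad X(t) - X(s) \le \overline{X}(t) - \overline{X}(s) \quad \text{for all } t \ge s \ge 0.$$ Let $R$ and $\overline{R}$ be two $d \times d$ reflection nonsingular $\mathcal{M}$-matrices with $R \le \overline{R}$. Let $Z$ and $\overline{Z}$ be the solutions to the Skorohod problems in the orthant $S$ with reflection matrices $R$, $\overline{R}$ and driving functions $X$, $\overline{X}$, respectively, and let $L$, $\overline{L}$ be the corresponding vectors of boundary terms. Then $$Z(t) \le \overline{Z}(t), \qquad L(t) - L(s) \ge \overline{L}(t) - \overline{L}(s), \qquad \text{for all } t \ge s \ge 0.$$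
   Context: Vectors and matrices of the same size are compared componentwise. $\mathbb{R}_+ = [0,\infty)$. A $d\times d$ matrix $R$ is a reflection nonsingular $\mathcal{M}$-matrix if $R = I_d - Q$ where $I_d$ is the identity matrix and $Q \ge 0$ has spectral radius less than $1$ and zeros on the main diagonal. Skorohod problem: for a continuous $X : \mathbb{R}_+ \to \mathbb{R}^d$ with $X(0) \in S = \mathbb{R}_+^d$, a solution to the Skorohod problem in $S$ with reflection matrix $R$ and driving function $X$ is a continuous function $Z : \mathbb{R}_+ \to S$ such that there is a continuous $L : \mathbb{R}_+ \to \mathbb{R}^d$ with: (i) $Z(t) = X(t) + R L(t)$ for all $t \ge 0$; (ii) for each $i = 1,\ldots,d$, $L_i$ is nondecreasing, $L_i(0)=0$, and $L_i$ can increase only when $Z_i(t) = 0$, i.e. $\int_0^\infty Z_i(t)\,dL_i(t) = 0$. $L$ is called the vector of boundary terms. When $R$ is a reflection nonsingular $\mathcal{M}$-matrix, the pair $(Z,L)$ exists and is unique (known result). *)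

theory Defs
  imports "HOL-Analysis.Analysis"
begin

definition spectrum :: "complex ^ 'n ^ 'n \<Rightarrow> complex set" where
  "spectrum A = {k. \<exists>v. v \<noteq> 0 \<and> A *v v = k *s v}"

(* The spectrum is nonempty and finite, so the supremum is a maximum. *)
definition spectral_radius :: "complex ^ 'n ^ 'n \<Rightarrow> real" where
  "spectral_radius A = (SUP k\<in>spectrum A. norm k)"

(* The order on real ^ 'n and on real ^ 'n ^ 'n is the componentwise one.
   The spectral radius of a real matrix refers to its complex eigenvalues. *)
definition reflection_nonsingular_M_matrix :: "real ^ 'n ^ 'n \<Rightarrow> bool" where
  "reflection_nonsingular_M_matrix R \<longleftrightarrow>
     (\<exists>Q. R = mat 1 - Q \<and> 0 \<le> Q \<and> (\<forall>i. Q $ i $ i = 0)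
        \<and> spectral_radius (map_matrix complex_of_real Q) < 1)"

definition orthant :: "(real ^ 'n) set" where
  "orthant = {x. 0 \<le> x}"

(* Z is a solution with vector of boundary terms L. Only values at times t \<ge> 0 matter.
   For the Stieltjes integral, each component of L is extended by L 0 = 0 to negative times;
   since this extension is nondecreasing and continuous, interval_measure gives its
   Lebesgue-Stieltjes measure, and the integrand is nonnegative because Z stays in the orthant. *)
definition skorohod_solution ::
  "real ^ 'n ^ 'n \<Rightarrow> (real \<Rightarrow> real ^ 'n) \<Rightarrow> (real \<Rightarrow> real ^ 'n) \<Rightarrow> (real \<Rightarrow> real ^ 'n) \<Rightarrow> bool" where
  "skorohod_solution R X Z L \<longleftrightarrow>
     continuous_on {0..} Z \<and> Z ` {0..} \<subseteq> orthant \<and>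
     continuous_on {0..} L \<and>
     (\<forall>t\<ge>0. Z t = X t + R *v L t) \<and>
     (\<forall>i. mono_on {0..} (\<lambda>t. L t $ i) \<and> L 0 $ i = 0 \<and>
        (\<integral>\<^sup>+ t\<in>{0..}. ennreal (Z t $ i) \<partial>interval_measure (\<lambda>t. L (max 0 t) $ i)) = 0)"

end

theory Submission
  imports Defs
begin

text \<open>Put \<open>D = Z - Z'\<close>, \<open>N = L - L'\<close> and \<open>Q = I - R\<close>. Call a nondecreasing \<open>m\<close> with \<open>m 0 = 0\<close>
  dominating if \<open>- dN \<le> dm\<close>. Since \<open>dX \<le> dX'\<close> and \<open>R \<le> R'\<close>, then \<open>dD \<le> dN + Q dm\<close>.
  While \<open>D i > 0\<close> the term \<open>L i\<close> is constant, while \<open>D i < 0\<close> the term \<open>L' i\<close> is constant, and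
  this yields \<open>dD\<^sup>+ + (dN)\<^sup>- \<le> Q dm\<close>; hence \<open>Q m - D\<^sup>+\<close> is again dominating.
  The infimum \<open>a\<close> of the dominating functions at a fixed time therefore satisfies
  \<open>0 \<le> a \<le> Q a\<close>, which forces \<open>a = 0\<close> because \<open>Q\<close> has spectral radius below 1. So \<open>N\<close> is
  nondecreasing, \<open>m = 0\<close> is dominating, and \<open>dD\<^sup>+ \<le> 0\<close> with \<open>D 0 \<le> 0\<close> gives \<open>D \<le> 0\<close>.\<close>

section \<open>Last exit times and flat pieces of Stieltjes integrators\<close>

text \<open>The time \<open>u\<close> is the maximum of the compact set where \<open>f\<close> is at
  most 0, or \<open>s\<close> if that set is empty. In the first case the intermediate value theorem
  makes \<open>f\<close> vanish at \<open>u\<close>.\<close>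

lemma last_exit_time:
  fixes f :: "real \<Rightarrow> real"
  assumes cont: "continuous_on {s..t} f" and "s \<le> t" and "0 < f t"
  obtains u where "s \<le> u" "u \<le> t" "\<And>r. u < r \<Longrightarrow> r \<le> t \<Longrightarrow> 0 < f r"
    "f u = 0 \<or> u = s \<and> 0 < f s"
proof (cases "\<exists>r\<in>{s..t}. f r \<le> 0")
  case False
  then have pos: "0 < f r" if "s \<le> r" "r \<le> t" for r
    using that by force
  show thesis
    by (rule that[of s]) (use pos \<open>s \<le> t\<close> in auto)
next
  case True
  define A where "A = {r \<in> {s..t}. f r \<le> 0}"
  have "closed A"
    unfolding A_def by (intro continuous_closed_preimage_constant continuous_on_closed_Collect_le assms continuous_on_const) auto
  moreover have "bounded A"
    by (rule bounded_subset[of "{s..t}"]) (auto simp: A_def)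
  ultimately have "compact A" by (simp add: compact_eq_bounded_closed)
  then obtain u where u: "u \<in> A" "\<And>r. r \<in> A \<Longrightarrow> r \<le> u"
    using compact_attains_sup[of A] True unfolding A_def by blast
  have pos: "0 < f r" if "u < r" "r \<le> t" for r
    using u(1) u(2)[of r] that by (force simp: A_def)
  have "continuous_on {u..t} f"
    using u(1) by (auto intro: continuous_on_subset[OF cont] simp: A_def)
  then obtain r where "u \<le> r" "r \<le> t" "f r = 0"
    using IVT'[of f u 0 t] u(1) \<open>0 < f t\<close> by (auto simp: A_def)
  then have "f u = 0"
    using pos[of r] by (cases "r = u") auto
  then show thesis
    using that[of u] u(1) pos by (auto simp: A_def)
qed

text \<open>A nonnegative integrand with zero integral vanishes almost everywhere, so
  \<open>{u<..t}\<close>, where it is positive, is a null set, and its measure is the increment of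
  \<open>l\<close>. The interval is half-open because \<open>z\<close> may vanish at
  \<open>u\<close>.\<close>

lemma null_stieltjes_integral_imp_flat:
  fixes l z :: "real \<Rightarrow> real"
  assumes l: "continuous_on {0..} l" "mono_on {0..} l"
    and z: "continuous_on {0..} z"
    and null: "(\<integral>\<^sup>+ t\<in>{0..}. ennreal (z t) \<partial>interval_measure (\<lambda>t. l (max 0 t))) = 0"
    and "0 \<le> u" "u \<le> t" and pos: "\<And>r. u < r \<Longrightarrow> r \<le> t \<Longrightarrow> 0 < z r"
  shows "l t = l u"
proof -
  define F where "F = (\<lambda>t. l (max 0 t))"
  define M where "M = interval_measure F"
  have F_mono: "F x \<le> F y" if "x \<le> y" for x y
    using that mono_onD[OF l(2)] by (auto simp: F_def)
  have "continuous_on UNIV F"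
    unfolding F_def by (rule continuous_on_compose2[OF l(1)]) (auto intro!: continuous_intros)
  then have F_cont: "continuous (at_right x) F" for x
    by (auto simp: continuous_on_eq_continuous_within intro: continuous_within_subset)
  \<comment> \<open>Continuity of \<open>z\<close> is known on \<open>{0..}\<close> only, so
    measurability is proved with the indicator inside \<open>ennreal\<close>, which is then moved
    outside.\<close>
  have "(\<lambda>r. indicator {0..} r * z r) \<in> borel_measurable borel"
    using borel_measurable_continuous_on_indicator[OF _ z] by simp
  then have "(\<lambda>r. ennreal (indicator {0..} r * z r)) \<in> borel_measurable M"
    by (simp add: M_def measurable_cong_sets[OF sets_interval_measure refl])
  moreover have eq: "(\<lambda>r. ennreal (indicator {0..} r * z r)) = (\<lambda>r. ennreal (z r) * indicator {0..} r)"
    by (auto simp: indicator_def)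
  ultimately have "(\<lambda>r. ennreal (z r) * indicator {0..} r) \<in> borel_measurable M"
    by simp
  moreover have "(\<integral>\<^sup>+ r. ennreal (z r) * indicator {0..} r \<partial>M) = 0"
    using null by (simp only: M_def F_def)
  ultimately have "AE r in M. ennreal (z r) * indicator {0..} r = 0"
    by (simp only: nn_integral_0_iff_AE)
  then have "AE r in M. r \<notin> {u<..t}"
    by eventually_elim (use pos \<open>0 \<le> u\<close> in \<open>force simp: indicator_def ennreal_eq_0_iff not_le split: if_splits\<close>)
  then have "emeasure M {u<..t} = 0"
    by (subst (asm) AE_iff_measurable[of "{u<..t}"]) (auto simp: M_def)
  moreover have "emeasure M {u<..t} = ennreal (F t - F u)"
    unfolding M_def using emeasure_interval_measure_Ioc[OF \<open>u \<le> t\<close> F_mono F_cont] .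
  ultimately have "F t \<le> F u"
    by (simp add: ennreal_eq_0_iff)
  with F_mono[OF \<open>u \<le> t\<close>] show ?thesis
    using assms(5,6) by (simp add: F_def)
qed

text \<open>One coordinate of the bound on the positive part of \<open>D\<close> and the decrease of
  \<open>N\<close>; here \<open>m\<close> stands for that coordinate of \<open>Q m\<close>. Go back
  from \<open>t\<close> to the last zero \<open>u\<close> of \<open>D\<close>, or to
  \<open>s\<close>. After \<open>u\<close> the sign of \<open>D\<close> is constant, so one boundary
  term is flat; up to \<open>u\<close>, \<open>incr\<close> controls the decrease of
  \<open>N\<close> because \<open>D u = 0\<close>.\<close>

lemma positive_part_increment:
  fixes z z' l l' m :: "real \<Rightarrow> real"
  assumes z: "continuous_on {0..} z" "\<And>t. 0 \<le> t \<Longrightarrow> 0 \<le> z t"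
    and z': "continuous_on {0..} z'" "\<And>t. 0 \<le> t \<Longrightarrow> 0 \<le> z' t"
    and mono: "mono_on {0..} l" "mono_on {0..} l'" "mono_on {0..} m"
    and flat: "\<And>u t. 0 \<le> u \<Longrightarrow> u \<le> t \<Longrightarrow> (\<And>r. u < r \<Longrightarrow> r \<le> t \<Longrightarrow> 0 < z r) \<Longrightarrow> l t = l u"
    and flat': "\<And>u t. 0 \<le> u \<Longrightarrow> u \<le> t \<Longrightarrow> (\<And>r. u < r \<Longrightarrow> r \<le> t \<Longrightarrow> 0 < z' r) \<Longrightarrow> l' t = l' u"
    and incr: "\<And>s t. 0 \<le> s \<Longrightarrow> s \<le> t \<Longrightarrow>
      (z t - z' t) - (z s - z' s) \<le> (l t - l' t) - (l s - l' s) + (m t - m s)"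
    and "0 \<le> s" "s \<le> t"
  shows "max 0 (z t - z' t) - max 0 (z s - z' s) + max 0 ((l s - l' s) - (l t - l' t)) \<le> m t - m s"
proof -
  define D where "D = (\<lambda>t. z t - z' t)"
  define N where "N = (\<lambda>t. l t - l' t)"
  have m: "m s \<le> m t" if "0 \<le> s" "s \<le> t" for s t
    using that mono_onD[OF mono(3)] by auto
  have contD: "continuous_on {s..t} D" if "0 \<le> s" for s t
    unfolding D_def using that
    by (auto intro!: continuous_intros continuous_on_subset[OF z(1)] continuous_on_subset[OF z'(1)])
  have incrD: "D t - D s \<le> N t - N s + (m t - m s)" if "0 \<le> s" "s \<le> t" for s t
    using incr[OF that] by (simp add: D_def N_def)
  \<comment> \<open>Where \<open>D\<close> is positive, \<open>z\<close> exceeds \<open>z'\<close>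
    and hence 0, so \<open>l\<close> is flat, while \<open>l'\<close> can only grow.\<close>
  have N_down: "N t \<le> N u" if "0 \<le> u" "u \<le> t" "\<And>r. u < r \<Longrightarrow> r \<le> t \<Longrightarrow> 0 < D r" for u t
  proof -
    have "l t = l u"
    proof (rule flat[OF that(1,2)])
      fix r assume "u < r" "r \<le> t"
      then show "0 < z r"
        using that(3)[of r] z'(2)[of r] \<open>0 \<le> u\<close> by (simp add: D_def)
    qed
    then show ?thesis
      using that mono_onD[OF mono(2), of u t] by (simp add: N_def)
  qed
  have N_up: "N u \<le> N t" if "0 \<le> u" "u \<le> t" "\<And>r. u < r \<Longrightarrow> r \<le> t \<Longrightarrow> 0 < - D r" for u t
  proof -
    have "l' t = l' u"
    proof (rule flat'[OF that(1,2)])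
      fix r assume "u < r" "r \<le> t"
      then show "0 < z' r"
        using that(3)[of r] z(2)[of r] \<open>0 \<le> u\<close> by (simp add: D_def)
    qed
    then show ?thesis
      using that mono_onD[OF mono(1), of u t] by (simp add: N_def)
  qed
  have zero: "N s - N t \<le> m t - m s + max 0 (D s)" if "D t = 0" "s \<le> t" for t
    using incrD[of s t] that \<open>0 \<le> s\<close> by simp
  have nonpos: "N s - N t \<le> m t - m s + max 0 (D s)" if Dt: "D t \<le> 0" and "s \<le> t" for t
  proof (cases "D t = 0")
    case True
    then show ?thesis using zero \<open>s \<le> t\<close> by simp
  next
    case False
    have "continuous_on {s..t} (\<lambda>r. - D r)"
      using contD[OF \<open>0 \<le> s\<close>] by (intro continuous_intros)
    moreover have "0 < - D t" using Dt False by simp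
    ultimately obtain u where u: "s \<le> u" "u \<le> t" "\<And>r. u < r \<Longrightarrow> r \<le> t \<Longrightarrow> 0 < - D r"
      "- D u = 0 \<or> u = s \<and> 0 < - D s"
      using last_exit_time[OF _ \<open>s \<le> t\<close>, of "\<lambda>r. - D r"] by blast
    have "N u \<le> N t" "m u \<le> m t"
      using N_up[of u t] m[of u t] u \<open>0 \<le> s\<close> by auto
    then show ?thesis
      using u(4) zero[of u] u(1) by auto
  qed
  have "max 0 (D t) - max 0 (D s) + max 0 (N s - N t) \<le> m t - m s"
  proof (cases "D t \<le> 0")
    case True
    then show ?thesis
      using nonpos[OF True \<open>s \<le> t\<close>] m[OF \<open>0 \<le> s\<close> \<open>s \<le> t\<close>] by (auto simp: max_def)
  next
    case False
    then have "0 < D t" by simp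
    then obtain u where u: "s \<le> u" "u \<le> t" "\<And>r. u < r \<Longrightarrow> r \<le> t \<Longrightarrow> 0 < D r"
      "D u = 0 \<or> u = s \<and> 0 < D s"
      using last_exit_time[OF contD[OF \<open>0 \<le> s\<close>] \<open>s \<le> t\<close>] by blast
    \<comment> \<open>If \<open>D u = 0\<close>, the third inequality is added to
      \<open>zero\<close> on the interval from \<open>s\<close> to \<open>u\<close>; if
      \<open>u = s\<close>, it suffices. The first two cover the case where the positive part of
      \<open>N s - N t\<close> is 0.\<close>
    have "N t \<le> N u" "m s \<le> m u" "D t - D u \<le> N t - N u + (m t - m u)"
      using N_down[of u t] m[of s u] incrD[of u t] u \<open>0 \<le> s\<close> by auto
    then show ?thesis
      using u(4) zero[of u] u(1) False by (auto simp: max_def)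
  qed
  then show ?thesis by (simp add: D_def N_def)
qed

section \<open>Spectral radius and subinvariant vectors\<close>

text \<open>The operator norm bounds every eigenvalue, so the real supremum is taken over a set that
  is bounded above.\<close>

lemma spectrum_norm_le_spectral_radius:
  fixes A :: "complex ^ 'n ^ 'n"
  assumes "k \<in> spectrum A"
  shows "norm k \<le> spectral_radius A"
proof -
  have "norm k \<le> onorm ((*v) A)" if k: "k \<in> spectrum A" for k
  proof -
    obtain v where v: "v \<noteq> 0" "A *v v = k *s v"
      using k by (auto simp: spectrum_def)
    have "norm (k *s v) = norm k * norm v"
      by (simp add: norm_vec_def L2_set_def norm_mult power_mult_distrib flip: sum_distrib_left)
         (simp add: real_sqrt_mult)
    moreover have "norm (A *v v) \<le> onorm ((*v) A) * norm v"
      by (rule onorm) (simp add: matrix_vector_mul_bounded_linear)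
    ultimately show ?thesis using v by simp
  qed
  then have "bdd_above (norm ` spectrum A)" by (rule bdd_aboveI2)
  then show ?thesis
    unfolding spectral_radius_def using assms by (rule cSUP_upper2[OF _ _ order_refl])
qed

text \<open>Brouwer's theorem applied to \<open>x \<mapsto> Q x / \<Sum> (Q x)\<close> on the simplex slice \<open>x \<le> Q x\<close>
  yields an eigenvalue that is at least 1.\<close>
lemma subinvariant_imp_zero:
  fixes Q :: "real ^ 'n ^ 'n"
  assumes Q: "0 \<le> Q" and rad: "spectral_radius (map_matrix complex_of_real Q) < 1"
    and a: "0 \<le> a" "a \<le> Q *v a"
  shows "a = 0"
proof (rule ccontr)
  assume "a \<noteq> 0"
  define S where "S = (\<lambda>x :: real ^ 'n. \<Sum>i\<in>UNIV. x $ i)"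
  define K where "K = {x. 0 \<le> x \<and> x \<le> Q *v x \<and> S x = 1}"
  have Q_nonneg: "0 \<le> Q $ i $ j" for i j
    using Q by (simp add: less_eq_vec_def)
  have Q_mono: "Q *v x \<le> Q *v y" if "x \<le> y" for x y
    using that Q_nonneg
    by (auto simp: less_eq_vec_def matrix_vector_mult_def intro!: sum_mono mult_left_mono)
  have S_scale: "S (c *\<^sub>R x) = c * S x" for c x
    by (simp add: S_def sum_distrib_left)
  have S_add: "S (x + y) = S x + S y" for x y
    by (simp add: S_def sum.distrib)
  have S_mono: "S x \<le> S y" if "x \<le> y" for x y
    using that by (auto simp: S_def less_eq_vec_def intro: sum_mono)
  have scale: "c *\<^sub>R x \<le> c *\<^sub>R y" if "0 \<le> c" "x \<le> y" for c and x y :: "real ^ 'n"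
    using that by (auto simp: less_eq_vec_def mult_left_mono)
  have "0 < S a"
  proof -
    obtain i where "a $ i \<noteq> 0" using \<open>a \<noteq> 0\<close> by (auto simp: vec_eq_iff)
    then show ?thesis
      using a(1) unfolding S_def
      by (intro sum_pos2[of _ i]) (auto simp: less_eq_vec_def less_le)
  qed
  have contQ: "continuous_on A ((*v) Q)" for A
    by (intro linear_continuous_on matrix_vector_mul_bounded_linear)
  have contS: "continuous_on A S" for A
    unfolding S_def by (intro continuous_intros)
  have "compact K"
  proof -
    have "closed {x. \<forall>i. 0 \<le> x $ i \<and> x $ i \<le> (Q *v x) $ i}"
      by (intro closed_Collect_all closed_Collect_conj closed_Collect_le
          continuous_intros continuous_on_component contQ)
    moreover have "closed {x. S x = 1}"
      by (intro closed_Collect_eq contS continuous_intros)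
    moreover have "K = {x. \<forall>i. 0 \<le> x $ i \<and> x $ i \<le> (Q *v x) $ i} \<inter> {x. S x = 1}"
      by (auto simp: K_def less_eq_vec_def)
    moreover have "bounded K"
    proof (rule boundedI)
      fix x assume "x \<in> K"
      then have "(\<Sum>i\<in>UNIV. \<bar>x $ i\<bar>) = 1"
        by (simp add: K_def S_def less_eq_vec_def)
      then show "norm x \<le> 1" using norm_le_l1_cart[of x] by simp
    qed
    ultimately show ?thesis by (simp add: compact_eq_bounded_closed closed_Int)
  qed
  moreover have "convex K"
  proof (rule convexI)
    fix x y :: "real ^ 'n" and u v :: real
    assume *: "x \<in> K" "y \<in> K" "0 \<le> u" "0 \<le> v" "u + v = 1"
    have "Q *v (u *\<^sub>R x + v *\<^sub>R y) = u *\<^sub>R (Q *v x) + v *\<^sub>R (Q *v y)"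
      by (simp add: matrix_vector_right_distrib matrix_vector_mult_scaleR)
    moreover have "u *\<^sub>R x \<le> u *\<^sub>R (Q *v x)" "v *\<^sub>R y \<le> v *\<^sub>R (Q *v y)"
      "u *\<^sub>R 0 \<le> u *\<^sub>R x" "v *\<^sub>R 0 \<le> v *\<^sub>R y"
      using * by (auto simp only: K_def mem_Collect_eq intro: scale)
    ultimately show "u *\<^sub>R x + v *\<^sub>R y \<in> K"
      using * by (auto simp: K_def S_add S_scale less_eq_vec_def add_mono)
  qed
  moreover have "(1 / S a) *\<^sub>R a \<in> K"
    using \<open>0 < S a\<close> a scale[of "1 / S a" 0 a] scale[of "1 / S a" a "Q *v a"]
    by (simp add: K_def S_scale matrix_vector_mult_scaleR)
  then have "K \<noteq> {}" by blast
  \<comment> \<open>This keeps the denominator of the normalised map away from 0 and later makes the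
    eigenvalue at least 1.\<close>
  moreover have SQ: "1 \<le> S (Q *v x)" if "x \<in> K" for x
    using that S_mono[of x "Q *v x"] by (simp add: K_def)
  then have "continuous_on K (\<lambda>x. (1 / S (Q *v x)) *\<^sub>R (Q *v x))"
    by (intro continuous_intros contQ continuous_on_compose2[OF contS contQ]) force+
  moreover have "(\<lambda>x. (1 / S (Q *v x)) *\<^sub>R (Q *v x)) \<in> K \<rightarrow> K"
  proof
    fix x assume x: "x \<in> K"
    define c where "c = 1 / S (Q *v x)"
    have c: "0 \<le> c" "c * S (Q *v x) = 1" using SQ[OF x] by (auto simp: c_def)
    \<comment> \<open>\<open>Q\<close> is monotone on vectors, so applying it to
      \<open>x \<le> Q *v x\<close> and normalising preserves all conditions of
      \<open>K\<close>.\<close>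
    have x': "0 \<le> x" "x \<le> Q *v x" using x by (auto simp: K_def)
    have "c *\<^sub>R 0 \<le> c *\<^sub>R (Q *v x)" "c *\<^sub>R (Q *v x) \<le> c *\<^sub>R (Q *v (Q *v x))"
      using x' Q_mono[of x "Q *v x"] c(1) by (auto simp only: intro: scale order_trans)
    then have "c *\<^sub>R (Q *v x) \<in> K"
      using c by (simp add: K_def S_scale matrix_vector_mult_scaleR)
    then show "(1 / S (Q *v x)) *\<^sub>R (Q *v x) \<in> K" by (simp add: c_def)
  qed
  ultimately obtain x where x: "x \<in> K" "(1 / S (Q *v x)) *\<^sub>R (Q *v x) = x"
    by (rule brouwer)
  define k where "k = S (Q *v x)"
  have k1: "1 \<le> k"
    using SQ[OF x(1)] by (simp add: k_def)
  have "k *\<^sub>R ((1 / k) *\<^sub>R (Q *v x)) = k *\<^sub>R x"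
    unfolding k_def x(2) ..
  with k1 have k: "1 \<le> k" "Q *v x = k *\<^sub>R x"
    by simp_all
  \<comment> \<open>The spectrum belongs to the complexified matrix, so the real eigenvector is
    embedded entrywise.\<close>
  define v where "v = (\<chi> i. complex_of_real (x $ i))"
  have "(map_matrix complex_of_real Q *v v) $ i = (complex_of_real k *s v) $ i" for i
  proof -
    have "(map_matrix complex_of_real Q *v v) $ i = complex_of_real ((Q *v x) $ i)"
      by (simp add: matrix_vector_mult_def map_matrix_def v_def)
    then show ?thesis by (simp add: k v_def)
  qed
  then have "map_matrix complex_of_real Q *v v = complex_of_real k *s v"
    by (simp add: vec_eq_iff)
  moreover have "x \<noteq> 0" using x(1) by (auto simp: K_def S_def)
  then have "v \<noteq> 0" by (auto simp: v_def vec_eq_iff)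
  ultimately have "complex_of_real k \<in> spectrum (map_matrix complex_of_real Q)"
    by (auto simp: spectrum_def)
  from spectrum_norm_le_spectral_radius[OF this] k(1) rad show False by simp
qed

section \<open>Comparison of the two Skorohod problems by dominating functions\<close>

theorem theorem3p1:
  fixes X X' Z Z' L L' :: "real \<Rightarrow> real ^ 'n" and R R' :: "real ^ 'n ^ 'n"
  assumes "continuous_on {0..} X" and "continuous_on {0..} X'"
    and "X 0 \<in> orthant" and "X' 0 \<in> orthant"
    and "X 0 \<le> X' 0"
    and "\<And>s t. 0 \<le> s \<Longrightarrow> s \<le> t \<Longrightarrow> X t - X s \<le> X' t - X' s"
    and "reflection_nonsingular_M_matrix R" and "reflection_nonsingular_M_matrix R'"
    and "R \<le> R'"
    and "skorohod_solution R X Z L" and "skorohod_solution R' X' Z' L'"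
  shows "\<forall>s t. 0 \<le> s \<and> s \<le> t \<longrightarrow> Z t \<le> Z' t \<and> L t - L s \<ge> L' t - L' s"
proof -
  obtain Q where RQ: "R = mat 1 - Q" and "0 \<le> Q"
    and rad: "spectral_radius (map_matrix complex_of_real Q) < 1"
    using assms(7) by (auto simp: reflection_nonsingular_M_matrix_def)
  then have Q_nonneg: "0 \<le> Q $ i $ j" for i j
    by (simp add: less_eq_vec_def)
  define D where "D = (\<lambda>i t. Z t $ i - Z' t $ i)"
  define N where "N = (\<lambda>i t. L t $ i - L' t $ i)"
  \<comment> \<open>Monotonicity and \<open>m 0 = 0\<close> make dominating functions nonnegative,
    so their infimum is bounded below.\<close>
  define dom where "dom = (\<lambda>i m. mono_on {0..} m \<and> m 0 = (0::real) \<and>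
    (\<forall>s t. 0 \<le> s \<longrightarrow> s \<le> t \<longrightarrow> N i s - N i t \<le> m t - m s))"
  have L_mono: "L s $ i \<le> L t $ i" "L' s $ i \<le> L' t $ i" if "0 \<le> s" "s \<le> t" for s t i
  proof -
    have "mono_on {0..} (\<lambda>t. L t $ i)" "mono_on {0..} (\<lambda>t. L' t $ i)"
      using assms(10,11) unfolding skorohod_solution_def by blast+
    then show "L s $ i \<le> L t $ i" "L' s $ i \<le> L' t $ i"
      using that by (auto dest: mono_onD[of _ _ s t])
  qed
  have zero: "L 0 $ i = 0" "L' 0 $ i = 0" for i
    using assms(10,11) unfolding skorohod_solution_def by auto
  have D0: "D i 0 \<le> 0" for i
  proof -
    have "L 0 = 0" "L' 0 = 0" using zero by (auto simp: vec_eq_iff)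
    then have "Z 0 = X 0" "Z' 0 = X' 0"
      using assms(10,11) unfolding skorohod_solution_def by auto
    then show ?thesis using assms(5) by (simp add: D_def less_eq_vec_def)
  qed
  have dom_incr: "D i t - D i s \<le> N i t - N i s +
      ((\<Sum>j\<in>UNIV. Q $ i $ j * m j t) - (\<Sum>j\<in>UNIV. Q $ i $ j * m j s))"
    if m: "\<And>j. dom j (m j)" and "0 \<le> s" "s \<le> t" for m i s t
  proof -
    have Zeq: "Z r = X r + R *v L r" "Z' r = X' r + R' *v L' r" if "0 \<le> r" for r
      using assms(10,11) that unfolding skorohod_solution_def by auto
    have R_mult: "(R *v x) $ i = x $ i - (\<Sum>j\<in>UNIV. Q $ i $ j * x $ j)" for x
      unfolding RQ by (simp add: matrix_vector_mult_diff_rdistrib) (simp add: matrix_vector_mult_def)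
    \<comment> \<open>The increments of \<open>L'\<close> are nonnegative, so replacing
      \<open>R'\<close> by \<open>R\<close> only enlarges the bound on the increment of
      \<open>D\<close>. What remains is \<open>R\<close> applied to the increment of
      \<open>N\<close>; writing \<open>R = mat 1 - Q\<close> exposes the decrease of
      \<open>N\<close>, which \<open>m\<close> dominates.\<close>
    have "(R *v (L' t - L' s)) $ i \<le> (R' *v (L' t - L' s)) $ i"
      unfolding matrix_vector_mult_def using \<open>R \<le> R'\<close> L_mono[OF that(2,3)]
      by (auto simp: less_eq_vec_def intro!: sum_mono mult_right_mono)
    moreover have "(X t - X s) $ i \<le> (X' t - X' s) $ i"
      using assms(6)[OF that(2,3)] by (simp add: less_eq_vec_def)
    ultimately have "D i t - D i s \<le> (R *v (L t - L s)) $ i - (R *v (L' t - L' s)) $ i"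
      using that by (simp add: D_def Zeq matrix_vector_mult_diff_distrib)
    also have "\<dots> = N i t - N i s + (\<Sum>j\<in>UNIV. Q $ i $ j * (N j s - N j t))"
      by (simp add: R_mult N_def sum_subtractf sum.distrib algebra_simps)
    also have "\<dots> \<le> N i t - N i s + (\<Sum>j\<in>UNIV. Q $ i $ j * (m j t - m j s))"
      using m that Q_nonneg by (auto simp: dom_def intro!: sum_mono mult_left_mono)
    finally show ?thesis by (simp add: sum_subtractf right_diff_distrib)
  qed
  have dom_key: "max 0 (D i t) - max 0 (D i s) + max 0 (N i s - N i t) \<le>
      (\<Sum>j\<in>UNIV. Q $ i $ j * m j t) - (\<Sum>j\<in>UNIV. Q $ i $ j * m j s)"
    if m: "\<And>j. dom j (m j)" and "0 \<le> s" "s \<le> t" for m i s t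
  proof -
    note sol = assms(10,11)[unfolded skorohod_solution_def orthant_def less_eq_vec_def]
    have cont: "continuous_on {0..} (\<lambda>t. Z t $ i)" "continuous_on {0..} (\<lambda>t. Z' t $ i)"
      "continuous_on {0..} (\<lambda>t. L t $ i)" "continuous_on {0..} (\<lambda>t. L' t $ i)"
      using sol by (auto intro!: continuous_on_component)
    have mono: "mono_on {0..} (\<lambda>t. L t $ i)" "mono_on {0..} (\<lambda>t. L' t $ i)"
      using sol by blast+
    have null: "(\<integral>\<^sup>+ t\<in>{0..}. ennreal (Z t $ i) \<partial>interval_measure (\<lambda>t. L (max 0 t) $ i)) = 0"
      "(\<integral>\<^sup>+ t\<in>{0..}. ennreal (Z' t $ i) \<partial>interval_measure (\<lambda>t. L' (max 0 t) $ i)) = 0"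
      using sol by blast+
    show ?thesis
      unfolding D_def N_def
    proof (rule positive_part_increment[OF cont(1) _ cont(2) _ mono])
      show "0 \<le> Z t $ i" "0 \<le> Z' t $ i" if "0 \<le> t" for t
        using sol that by (auto simp: image_subset_iff)
      show "mono_on {0..} (\<lambda>t. \<Sum>j\<in>UNIV. Q $ i $ j * m j t)"
        using m Q_nonneg by (auto simp: dom_def mono_on_def intro!: sum_mono mult_left_mono)
      show "L t $ i = L u $ i"
        if "0 \<le> u" "u \<le> t" "\<And>r. u < r \<Longrightarrow> r \<le> t \<Longrightarrow> 0 < Z r $ i" for u t
        using null_stieltjes_integral_imp_flat[OF cont(3) mono(1) cont(1) null(1)] that by blast
      show "L' t $ i = L' u $ i"
        if "0 \<le> u" "u \<le> t" "\<And>r. u < r \<Longrightarrow> r \<le> t \<Longrightarrow> 0 < Z' r $ i" for u t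
        using null_stieltjes_integral_imp_flat[OF cont(4) mono(2) cont(2) null(2)] that by blast
    qed (use dom_incr[OF m, unfolded D_def N_def] that in blast)+
  qed
  \<comment> \<open>Both properties come from \<open>dom_key\<close>: dropping the nonnegative term
    in \<open>N\<close> gives monotonicity, and bounding that term below by
    \<open>N i s - N i t\<close> gives domination. The value at 0 is right because
    \<open>D i 0 \<le> 0\<close>.\<close>
  have dom_step: "dom i (\<lambda>t. (\<Sum>j\<in>UNIV. Q $ i $ j * m j t) - max 0 (D i t))"
    if m: "\<And>j. dom j (m j)" for m i
    unfolding dom_def
  proof (intro conjI allI impI mono_onI)
    have "m j 0 = 0" for j using m by (simp add: dom_def)
    then show "(\<Sum>j\<in>UNIV. Q $ i $ j * m j 0) - max 0 (D i 0) = 0"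
      using D0[of i] by simp
  next
    fix s t :: real assume "s \<in> {0..}" "t \<in> {0..}" "s \<le> t"
    then show "(\<Sum>j\<in>UNIV. Q $ i $ j * m j s) - max 0 (D i s)
        \<le> (\<Sum>j\<in>UNIV. Q $ i $ j * m j t) - max 0 (D i t)"
      using dom_key[OF m, of s t i] by simp
  next
    fix s t :: real assume "0 \<le> s" "s \<le> t"
    then show "N i s - N i t \<le> (\<Sum>j\<in>UNIV. Q $ i $ j * m j t) - max 0 (D i t)
        - ((\<Sum>j\<in>UNIV. Q $ i $ j * m j s) - max 0 (D i s))"
      using dom_key[OF m, of s t i] by simp
  qed
  \<comment> \<open>The decrease of \<open>N\<close> is at most the growth of \<open>L'\<close>
    because \<open>L\<close> is nondecreasing. This makes the infimum below one over a nonempty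
    set.\<close>
  have dom_L': "dom i (\<lambda>t. L' t $ i)" for i
    using L_mono zero by (auto simp: dom_def N_def mono_on_def)
  have dom_ne: "Collect (dom i) \<noteq> {}" for i
    using dom_L' by blast
  have dom_nonneg: "0 \<le> m t" if "dom i m" "0 \<le> t" for i m t
    using that mono_onD[of "{0..}" m 0 t] by (auto simp: dom_def)

  \<comment> \<open>The infimum of the dominating functions at a fixed time\<close>
  have N_mono: "N i s \<le> N i t" if "0 \<le> s" "s \<le> t" for i s t
  proof -
    have "0 \<le> t" using that by simp
    define a where "a = (\<chi> i. INF m\<in>Collect (dom i). m t)"
    have bdd: "bdd_below ((\<lambda>m. m t) ` Collect (dom i))" for i
      using dom_nonneg \<open>0 \<le> t\<close> by (intro bdd_belowI2[of _ 0]) auto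
    have a_le: "a $ i \<le> m t" if "dom i m" for i m
      using that bdd by (auto simp: a_def intro: cINF_lower)
    have "0 \<le> a"
      using dom_nonneg \<open>0 \<le> t\<close> by (auto simp: a_def less_eq_vec_def intro!: cINF_greatest[OF dom_ne])
    moreover have "a \<le> Q *v a"
      unfolding less_eq_vec_def
    proof (intro allI)
      fix i
      define c where "c = (\<Sum>j\<in>UNIV. Q $ i $ j)"
      have c: "0 \<le> c" using Q_nonneg by (simp add: c_def sum_nonneg)
      \<comment> \<open>In each coordinate choose a dominating function within \<open>e\<close> of
        the infimum at time \<open>t\<close>. The improved function from \<open>dom_step\<close> is
        again an upper bound for \<open>a $ i\<close>, and the errors add up to the row sum
        \<open>c\<close> times \<open>e\<close>.\<close>
      have eps: "a $ i \<le> (Q *v a) $ i + c * e" if "0 < e" for e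
      proof -
        have "\<exists>m. dom j m \<and> m t < a $ j + e" for j
          using cINF_less_iff[OF dom_ne bdd, of j "a $ j + e"] \<open>0 < e\<close>
          by (auto simp: a_def)
        then obtain m where m: "\<And>j. dom j (m j)" "\<And>j. m j t < a $ j + e" by metis
        have "a $ i \<le> (\<Sum>j\<in>UNIV. Q $ i $ j * m j t) - max 0 (D i t)"
          by (rule a_le[OF dom_step[OF m(1)]])
        also have "\<dots> \<le> (\<Sum>j\<in>UNIV. Q $ i $ j * m j t)" by simp
        also have "\<dots> \<le> (\<Sum>j\<in>UNIV. Q $ i $ j * (a $ j + e))"
          using Q_nonneg m(2) by (intro sum_mono mult_left_mono less_imp_le[OF m(2)])
        finally show ?thesis
          by (simp add: matrix_vector_mult_def c_def distrib_left sum.distrib sum_distrib_right)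
      qed
      show "a $ i \<le> (Q *v a) $ i"
      proof (rule field_le_epsilon)
        fix e :: real assume "0 < e"
        \<comment> \<open>The denominator is \<open>c + 1\<close> because the row sum
          \<open>c\<close> may be 0.\<close>
        then have "a $ i \<le> (Q *v a) $ i + c * (e / (c + 1))"
          using c by (intro eps) simp
        also have "c * (e / (c + 1)) \<le> e"
          using c \<open>0 < e\<close> by (simp add: field_simps)
        finally show "a $ i \<le> (Q *v a) $ i + e" by simp
      qed
    qed
    ultimately have "a = 0"
      by (rule subinvariant_imp_zero[OF \<open>0 \<le> Q\<close> rad])
    \<comment> \<open>Each dominating \<open>m\<close> has \<open>m s\<close> nonnegative, so
      \<open>m t\<close> alone bounds the decrease of \<open>N\<close> from \<open>s\<close> to
      \<open>t\<close>, and so does the infimum.\<close>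
    moreover have "N i s - N i t \<le> a $ i"
    proof -
      have "N i s - N i t \<le> m t" if "dom i m" for m
        using dom_nonneg[OF that \<open>0 \<le> s\<close>] that \<open>0 \<le> s\<close> \<open>s \<le> t\<close> by (fastforce simp: dom_def)
      then show ?thesis
        unfolding a_def by (auto intro!: cINF_greatest[OF dom_ne])
    qed
    ultimately show ?thesis by simp
  qed
  have "dom j (\<lambda>t. 0)" for j
    using N_mono by (simp add: dom_def mono_on_def)
  then have D: "D i t \<le> 0" if "0 \<le> t" for i t
    using dom_key[of "\<lambda>j t. 0" 0 t i] D0[of i] that by (auto simp: max_def split: if_splits)
  show ?thesis
  proof (intro allI impI conjI; elim conjE)
    fix s t :: real assume st: "0 \<le> s" "s \<le> t"
    then show "Z t \<le> Z' t"
      using D[of t] by (simp add: less_eq_vec_def D_def)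
    have "L' t $ i - L' s $ i \<le> L t $ i - L s $ i" for i
      using N_mono[OF st, of i] by (simp add: N_def)
    then show "L' t - L' s \<le> L t - L s"
      by (simp add: less_eq_vec_def)
  qed
qed

end
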